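(* Let $k\in\{2,3\}$. Suppose that for all $i,j$ the solution polynomial $p_{ij}$ (with components in $\mathbb P^k$) satisfies $$u_{i-\frac12,q}^{+}\in G,\quad u_{i+\frac12,q}^{-}\in G,\quad u_{q,j-\frac12}^{+}\in G,\quad u_{q,j+\frac12}^{-}\in G,\qquad q=1,\dots,Q,$$ and $p_{ij}(x,y)\in G$ for all $(x,y)\in\mathbb S_{ij}^{\tt optimal}$. Then the values $\bar u_{ij}^{n+1}$ defined by the high-order scheme in the context satisfy $\bar u_{ij}^{n+1}\in G$ for all $i,j$ under the CFL condition $$\left[2\frac{a_1}{\Delta x}+2\frac{a_2}{\Delta y}+4\max\left\{\frac{a_1}{\Delta x},\frac{a_2}{\Delta y}\right\}\right]\Delta t\le c_0.$$
   Context: Mesh and polynomials. $\mathbb P^k$ is the space of polynomials in two variables of total degree at most $k$. The plane is partitioned into rectangular cells $\Omega_{ij}=[x_{i-\frac12},x_{i+\frac12}]\times[y_{j-\frac12},y_{j+\frac12}]$ with center $(x_i,y_j)$ and side lengths $\Delta x$, $\Delta y$. $G\subset\mathbb R^m$ is a convex set. On each cell, $p_{ij}$ is an $\mathbb R^m$-valued polynomial with components in $\mathbb P^k$, with cell average $\bar u_{ij}^n=\frac1{\Delta x\Delta y}\int_{\Omega_{ij}}p_{ij}\,dx\,dy$. Let $\{x_{i,q}^{\tt G}\}_{q=1}^Q$ and $\{y_{j,q}^{\tt G}\}_{q=1}^Q$ be the $Q$-point Gauss quadrature nodes in $[x_{i-\frac12},x_{i+\frac12}]$ and $[y_{j-\frac12},y_{j+\frac12}]$,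 with positive weights $\omega_q^{\tt G}$ normalized by $\sum_{q=1}^Q\omega_q^{\tt G}=1$; $Q$ is such that this rule is exact for univariate polynomials of degree at most $k$ (typically $Q=k+1$). Set $$u_{i-\frac12,q}^{+}=p_{ij}(x_{i-\frac12},y_{j,q}^{\tt G}),\quad u_{i+\frac12,q}^{-}=p_{ij}(x_{i+\frac12},y_{j,q}^{\tt G}),\quad u_{q,j-\frac12}^{+}=p_{ij}(x_{i,q}^{\tt G},y_{j-\frac12}),\quad u_{q,j+\frac12}^{-}=p_{ij}(x_{i,q}^{\tt G},y_{j+\frac12})$$ (the index $j$, resp. $i$, is suppressed in the first two, resp. last two, symbols). Scheme. For a time step $\Delta t>0$, $$\bar u_{ij}^{n+1}=\bar u_{ij}^n-\frac{\Delta t}{\Delta x}\sum_{q=1}^Q\omega_q^{\tt G}\left[\hat f_1(u_{i+\frac12,q}^-,u_{i+\frac12,q}^+)-\hat f_1(u_{i-\frac12,q}^-,u_{i-\frac12,q}^+)\right]-\frac{\Delta t}{\Delta y}\sum_{q=1}^Q\omega_q^{\tt G}\left[\hat f_2(u_{q,j+\frac12}^-,u_{q,j+\frac12}^+)-\hat f_2(u_{q,j-\frac12}^-,u_{q,j-\frac12}^+)\right],$$ where $u_{i+\frac12,q}^+$, $u_{i-\frac12,q}^-$, $u_{q,j+\frac12}^+$, $u_{q,j-\frac12}^-$ are the corresponding values of the polynomials of the neighbouring cells. Fluxes. $\hat f_1,\hat f_2$ are bound-preserving (BP) numerical fluxes: there are constants $a_1,a_2>0$ (maximum characteristic speeds in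 the $x$- and $y$-directions) and $c_0>0$ such that, for each $r\in\{1,2\}$, all $u_1,u_2,u_3\in G$ and all $\lambda>0$ with $a_r\lambda\le c_0$, $$u_2-\lambda\left(\hat f_r(u_2,u_3)-\hat f_r(u_1,u_2)\right)\in G.$$ Optimal node set. Let $\phi_1=\frac{a_1}{\Delta x}$, $\phi_2=\frac{a_2}{\Delta y}$, $\phi_*=\max\{\phi_1,\phi_2\}$. Then $\mathbb S_{ij}^{\tt optimal}$ consists of the points $$\left(x_i,\ y_j\pm\frac{\Delta y}{2\sqrt3}\sqrt{\frac{\phi_*-\phi_2}{\phi_*}}\right)\ \text{if }\phi_1\ge\phi_2,\qquad\left(x_i\pm\frac{\Delta x}{2\sqrt3}\sqrt{\frac{\phi_*-\phi_1}{\phi_*}},\ y_j\right)\ \text{if }\phi_1<\phi_2.$$ *)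

theory Defs
  imports "HOL-Analysis.Analysis" "HOL-Computational_Algebra.Polynomial"
begin

text \<open>Points of a uniform one-dimensional grid. The index is real, so that cell centers are
  \<open>grid x0 h i\<close> and cell interfaces are \<open>grid x0 h (i - 1/2)\<close> and \<open>grid x0 h (i + 1/2)\<close>, for
  an integer \<open>i\<close>.\<close>

definition grid :: "real \<Rightarrow> real \<Rightarrow> real \<Rightarrow> real" where
  "grid x0 h s = x0 + s * h"

definition cell :: "real \<Rightarrow> real \<Rightarrow> real \<Rightarrow> real \<Rightarrow> int \<Rightarrow> int \<Rightarrow> (real \<times> real) set" where
  "cell x0 y0 dx dy i j =
     {grid x0 dx (of_int i - 1/2) .. grid x0 dx (of_int i + 1/2)} \<times>
     {grid y0 dy (of_int j - 1/2) .. grid y0 dy (of_int j + 1/2)}"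

definition cell_average ::
  "real \<Rightarrow> real \<Rightarrow> real \<Rightarrow> real \<Rightarrow> int \<Rightarrow> int \<Rightarrow> (real \<times> real \<Rightarrow> real ^ 'm) \<Rightarrow> real ^ 'm" where
  "cell_average x0 y0 dx dy i j p = (1 / (dx * dy)) *\<^sub>R integral (cell x0 y0 dx dy i j) p"

text \<open>Polynomial functions of total degree at most \<open>k\<close> (not of degree at most \<open>k\<close> in each variable).\<close>

definition poly_space :: "nat \<Rightarrow> (real \<times> real \<Rightarrow> real) set" where
  "poly_space k =
     {r. \<exists>c :: nat \<Rightarrow> nat \<Rightarrow> real. \<forall>x y. r (x, y) = (\<Sum>a\<le>k. \<Sum>b\<le>k - a. c a b * x ^ a * y ^ b)}"

text \<open>Weights are normalized to sum to 1, so a rule approximates the mean over \<open>{a..b}\<close>.\<close>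

definition quadrature_exact ::
  "real \<Rightarrow> real \<Rightarrow> nat \<Rightarrow> (nat \<Rightarrow> real) \<Rightarrow> (nat \<Rightarrow> real) \<Rightarrow> nat \<Rightarrow> bool" where
  "quadrature_exact a b Q z w d \<longleftrightarrow>
     (\<forall>r :: real poly. degree r \<le> d \<longrightarrow>
        (\<Sum>q = 1..Q. w q * poly r (z q)) = (1 / (b - a)) * integral {a..b} (poly r))"

text \<open>The \<open>Q\<close>-point Gauss rule on \<open>{a..b}\<close> is the \<open>Q\<close>-point rule of degree of exactness
  \<open>2 * Q - 1\<close>; this determines the nodes and weights up to their enumeration by \<open>{1..Q}\<close>.\<close>

definition gauss_quadrature ::
  "real \<Rightarrow> real \<Rightarrow> nat \<Rightarrow> (nat \<Rightarrow> real) \<Rightarrow> (nat \<Rightarrow> real) \<Rightarrow> bool" where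
  "gauss_quadrature a b Q z w \<longleftrightarrow>
     1 \<le> Q \<and> inj_on z {1..Q} \<and> z ` {1..Q} \<subseteq> {a..b} \<and>
     (\<forall>q\<in>{1..Q}. 0 < w q) \<and> (\<Sum>q = 1..Q. w q) = 1 \<and>
     quadrature_exact a b Q z w (2 * Q - 1)"

definition bp_flux ::
  "(real ^ 'm) set \<Rightarrow> real \<Rightarrow> real \<Rightarrow> (real ^ 'm \<Rightarrow> real ^ 'm \<Rightarrow> real ^ 'm) \<Rightarrow> bool" where
  "bp_flux G a c0 f \<longleftrightarrow>
     (\<forall>u1\<in>G. \<forall>u2\<in>G. \<forall>u3\<in>G. \<forall>l>0. a * l \<le> c0 \<longrightarrow> u2 - l *\<^sub>R (f u2 u3 - f u1 u2) \<in> G)"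

definition optimal_nodes ::
  "real \<Rightarrow> real \<Rightarrow> real \<Rightarrow> real \<Rightarrow> real \<Rightarrow> real \<Rightarrow> int \<Rightarrow> int \<Rightarrow> (real \<times> real) set" where
  "optimal_nodes a1 a2 x0 y0 dx dy i j =
     (let phi1 = a1 / dx; phi2 = a2 / dy; phis = max phi1 phi2;
          x = grid x0 dx (of_int i); y = grid y0 dy (of_int j);
          ex = dx / (2 * sqrt 3) * sqrt ((phis - phi1) / phis);
          ey = dy / (2 * sqrt 3) * sqrt ((phis - phi2) / phis)
      in if phi1 \<ge> phi2 then {(x, y + ey), (x, y - ey)} else {(x + ex, y), (x - ex, y)})"

text \<open>The new average over cell \<open>(i, j)\<close>. At each interface the first flux argument is
  the trace from the left (lower) cell and the second the trace from the right (upper) cell;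
  \<open>xG i q\<close> and \<open>yG j q\<close> are the quadrature nodes in the \<open>i\<close>-th and \<open>j\<close>-th grid intervals.\<close>

definition scheme_update ::
  "real \<Rightarrow> real \<Rightarrow> real \<Rightarrow> real \<Rightarrow> real \<Rightarrow> nat \<Rightarrow> (nat \<Rightarrow> real) \<Rightarrow>
   (int \<Rightarrow> nat \<Rightarrow> real) \<Rightarrow> (int \<Rightarrow> nat \<Rightarrow> real) \<Rightarrow>
   (real ^ 'm \<Rightarrow> real ^ 'm \<Rightarrow> real ^ 'm) \<Rightarrow> (real ^ 'm \<Rightarrow> real ^ 'm \<Rightarrow> real ^ 'm) \<Rightarrow>
   (int \<Rightarrow> int \<Rightarrow> real \<times> real \<Rightarrow> real ^ 'm) \<Rightarrow> int \<Rightarrow> int \<Rightarrow> real ^ 'm" where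
  "scheme_update x0 y0 dx dy dt Q w xG yG f1 f2 p i j =
     (let xl = grid x0 dx (of_int i - 1/2); xr = grid x0 dx (of_int i + 1/2);
          yl = grid y0 dy (of_int j - 1/2); yr = grid y0 dy (of_int j + 1/2)
      in cell_average x0 y0 dx dy i j (p i j)
         - (dt / dx) *\<^sub>R (\<Sum>q = 1..Q. w q *\<^sub>R
             (f1 (p i j (xr, yG j q)) (p (i + 1) j (xr, yG j q))
              - f1 (p (i - 1) j (xl, yG j q)) (p i j (xl, yG j q))))
         - (dt / dy) *\<^sub>R (\<Sum>q = 1..Q. w q *\<^sub>R
             (f2 (p i j (xG i q, yr)) (p i (j + 1) (xG i q, yr))
              - f2 (p i (j - 1) (xG i q, yl)) (p i j (xG i q, yl)))))"

end

theory Submission imports Defs begin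

text \<open>Write \<open>S = \<phi>\<^sub>1 + \<phi>\<^sub>2 + 2 \<phi>\<^sub>*\<close>. On the cubic polynomials, the cell average is the convex combination,
  with weights \<open>\<phi>\<^sub>1/S\<close>, \<open>\<phi>\<^sub>2/S\<close> and \<open>2 \<phi>\<^sub>*/S\<close>, of the mean over the two vertical edges, the mean over
  the two horizontal edges, and the mean of the two optimal nodes: by symmetry about the cell center
  only \<open>1\<close>, \<open>x\<^sup>2\<close> and \<open>y\<^sup>2\<close> have to be compared. Gauss quadrature turns the edge means into averages of
  traces, and each flux difference across the cell is then absorbed by one pair of opposite traces,
  with time step ratio \<open>2 S \<Delta>t / a\<^sub>r\<close>; the CFL condition says precisely that this is admissible for
  the bound-preserving fluxes.\<close>

section \<open>Polynomials of bounded total degree and their restrictions to lines\<close>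

text \<open>Padding with zero coefficients lets every degree up to 3 be treated as the cubic
  case.\<close>

lemma poly_space_mono:
  assumes "k \<le> k'"
  shows "poly_space k \<subseteq> poly_space k'"
proof
  fix r assume "r \<in> poly_space k"
  then obtain c where c: "\<And>x y. r (x, y) = (\<Sum>a\<le>k. \<Sum>b\<le>k - a. c a b * x ^ a * y ^ b)"
    by (auto simp: poly_space_def)
  define c' where "c' a b = (if a + b \<le> k then c a b else 0)" for a b
  have "r (x, y) = (\<Sum>a\<le>k'. \<Sum>b\<le>k' - a. c' a b * x ^ a * y ^ b)" for x y
  proof -
    have "(\<Sum>a\<le>k'. \<Sum>b\<le>k' - a. c' a b * x ^ a * y ^ b) = (\<Sum>a\<le>k. \<Sum>b\<le>k' - a. c' a b * x ^ a * y ^ b)"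
      using assms by (intro sum.mono_neutral_right) (auto simp: c'_def)
    also have "\<dots> = (\<Sum>a\<le>k. \<Sum>b\<le>k - a. c' a b * x ^ a * y ^ b)"
      using assms by (intro sum.cong sum.mono_neutral_right) (auto simp: c'_def)
    also have "\<dots> = r (x, y)"
      unfolding c by (intro sum.cong) (auto simp: c'_def)
    finally show ?thesis by simp
  qed
  then show "r \<in> poly_space k'"
    unfolding poly_space_def by blast
qed

lemma poly_space_slice_right:
  assumes "r \<in> poly_space k"
  obtains P where "degree P \<le> k" "\<And>y. poly P y = r (x, y)"
proof -
  from assms obtain c where c: "\<And>x y. r (x, y) = (\<Sum>a\<le>k. \<Sum>b\<le>k - a. c a b * x ^ a * y ^ b)"
    by (auto simp: poly_space_def)
  define P where "P = (\<Sum>a\<le>k. \<Sum>b\<le>k - a. monom (c a b * x ^ a) b)"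
  have "degree P \<le> k"
    unfolding P_def
    by (intro degree_sum_le) (auto intro: order_trans[OF degree_monom_le])
  moreover have "poly P y = r (x, y)" for y
    by (simp add: P_def c poly_sum poly_monom)
  ultimately show thesis by (rule that)
qed

lemma poly_space_slice_left:
  assumes "r \<in> poly_space k"
  obtains P where "degree P \<le> k" "\<And>x. poly P x = r (x, y)"
proof -
  from assms obtain c where c: "\<And>x y. r (x, y) = (\<Sum>a\<le>k. \<Sum>b\<le>k - a. c a b * x ^ a * y ^ b)"
    by (auto simp: poly_space_def)
  define P where "P = (\<Sum>a\<le>k. \<Sum>b\<le>k - a. monom (c a b * y ^ b) a)"
  have "degree P \<le> k"
    unfolding P_def
    by (intro degree_sum_le) (auto intro: order_trans[OF degree_monom_le])
  moreover have "poly P x = r (x, y)" for x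
    by (simp add: P_def c poly_sum poly_monom mult_ac)
  ultimately show thesis by (rule that)
qed

lemma continuous_on_poly_space:
  assumes "r \<in> poly_space k"
  shows "continuous_on S r"
proof -
  from assms obtain c where c: "\<And>x y. r (x, y) = (\<Sum>a\<le>k. \<Sum>b\<le>k - a. c a b * x ^ a * y ^ b)"
    by (auto simp: poly_space_def)
  have "r = (\<lambda>z. \<Sum>a\<le>k. \<Sum>b\<le>k - a. c a b * fst z ^ a * snd z ^ b)"
    using c by (auto simp: fun_eq_iff)
  then show ?thesis
    by (auto intro!: continuous_intros)
qed

text \<open>Total degree bounds the degree in each variable, so the restriction to a vertical line
  is a univariate polynomial to which exactness applies.\<close>

lemma quadrature_exact_slice_right:
  assumes "quadrature_exact a b Q z w k" "r \<in> poly_space k"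
  shows "(\<Sum>q = 1..Q. w q * r (x, z q)) = integral {a..b} (\<lambda>y. r (x, y)) / (b - a)"
proof -
  obtain P where P: "degree P \<le> k" "\<And>y. poly P y = r (x, y)"
    using poly_space_slice_right[OF assms(2), where x = x] by blast
  from assms(1) P(1) have "(\<Sum>q = 1..Q. w q * poly P (z q)) = 1 / (b - a) * integral {a..b} (poly P)"
    unfolding quadrature_exact_def by blast
  then show ?thesis
    by (simp add: P(2)[abs_def])
qed

lemma quadrature_exact_slice_left:
  assumes "quadrature_exact a b Q z w k" "r \<in> poly_space k"
  shows "(\<Sum>q = 1..Q. w q * r (z q, y)) = integral {a..b} (\<lambda>x. r (x, y)) / (b - a)"
proof -
  obtain P where P: "degree P \<le> k" "\<And>x. poly P x = r (x, y)"
    using poly_space_slice_left[OF assms(2), where y = y] by blast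
  from assms(1) P(1) have "(\<Sum>q = 1..Q. w q * poly P (z q)) = 1 / (b - a) * integral {a..b} (poly P)"
    unfolding quadrature_exact_def by blast
  then show ?thesis
    by (simp add: P(2)[abs_def])
qed

section \<open>Means of cubics over the cell, its edges and the optimal nodes\<close>

lemma cubic_expansion:
  assumes "r \<in> poly_space 3"
  obtains d :: "nat \<Rightarrow> nat \<Rightarrow> real" where
    "\<And>s t. r (x + s, y + t) = (d 0 0 + d 0 1 * t + d 0 2 * t^2 + d 0 3 * t^3)
       + (d 1 0 + d 1 1 * t + d 1 2 * t^2) * s + (d 2 0 + d 2 1 * t) * s^2 + d 3 0 * s^3"
proof -
  from assms obtain c where c: "\<And>x y. r (x, y) = (\<Sum>a\<le>3. \<Sum>b\<le>3 - a. c a b * x ^ a * y ^ b)"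
    by (auto simp: poly_space_def)
  \<comment> \<open>These are the Taylor coefficients at \<open>(x, y)\<close>, from the binomial
    expansion of \<open>(x + s) ^ a * (y + t) ^ b\<close>. Truncated subtraction in the exponents is
    harmless: \<open>a choose m\<close> vanishes for \<open>a < m\<close>.\<close>
  define d where "d m n = (\<Sum>a\<le>3. \<Sum>b\<le>3 - a.
      c a b * real (a choose m) * x ^ (a - m) * real (b choose n) * y ^ (b - n))" for m n
  show thesis
    by (rule that[of d])
       (simp add: c d_def eval_nat_numeral algebra_simps)
qed

text \<open>Odd powers of \<open>t\<close> integrate to zero over an interval symmetric about
  \<open>m\<close>, and \<open>h^2 / 12\<close> is the mean of \<open>t^2\<close>.\<close>

lemma mean_centered_cubic:
  fixes h :: real
  assumes "0 < h" "\<And>t. f (m + t) = d0 + d1 * t + d2 * t^2 + d3 * t^3"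
  shows "integral {m - h/2..m + h/2} f / h = d0 + d2 * (h^2 / 12)"
proof -
  define F where
    "F z = d0 * (z - m) + d1 * (z - m)^2 / 2 + d2 * (z - m)^3 / 3 + d3 * (z - m)^4 / 4" for z
  have f: "f z = d0 + d1 * (z - m) + d2 * (z - m)^2 + d3 * (z - m)^3" for z
    using assms(2)[of "z - m"] by simp
  have "(f has_integral (F (m + h/2) - F (m - h/2))) {m - h/2..m + h/2}"
    using assms(1)
    by (intro fundamental_theorem_of_calculus)
       (auto simp: F_def f has_real_derivative_iff_has_vector_derivative[symmetric]
             intro!: derivative_eq_intros)
  moreover have "F (m + h/2) - F (m - h/2) = h * (d0 + d2 * (h^2 / 12))"
    by (simp add: F_def field_simps eval_nat_numeral)
  ultimately show ?thesis
    using assms(1) by (simp add: integral_unique)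
qed

text \<open>With \<open>H = dx^2 / 12\<close>, the centered square in the first variable has mean
  \<open>H\<close> on the cell and on the horizontal edges, but \<open>3 * H\<close> on the vertical
  ones. The excess \<open>2 * phi1 * H\<close> of the vertical edges is compensated by the nodes
  exactly when \<open>phis * ex^2 = (phis - phi1) * H\<close>, which fixes the offset
  \<open>ex\<close>; likewise for \<open>ey\<close>.\<close>

lemma poly_space_mean_decomposition:
  fixes dx dy :: real
  assumes r: "r \<in> poly_space k" and k: "k \<le> 3"
    and mesh: "0 < dx" "0 < dy"
    and zx: "quadrature_exact (x - dx/2) (x + dx/2) Q zx w k"
    and zy: "quadrature_exact (y - dy/2) (y + dy/2) Q zy w k"
    and phi: "0 < phi1" "0 < phi2" and phis: "phis = max phi1 phi2"
    and ex: "ex = dx / (2 * sqrt 3) * sqrt ((phis - phi1) / phis)"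
    and ey: "ey = dy / (2 * sqrt 3) * sqrt ((phis - phi2) / phis)"
  shows "(phi1 + phi2 + 2 * phis) *
           (integral ({x - dx/2..x + dx/2} \<times> {y - dy/2..y + dy/2}) r / (dx * dy)) =
         phi1 * ((\<Sum>q = 1..Q. w q * r (x - dx/2, zy q)) + (\<Sum>q = 1..Q. w q * r (x + dx/2, zy q))) / 2
         + phi2 * ((\<Sum>q = 1..Q. w q * r (zx q, y - dy/2)) + (\<Sum>q = 1..Q. w q * r (zx q, y + dy/2))) / 2
         + phis * (r (x + ex, y + ey) + r (x - ex, y - ey))"
proof -
  have "r \<in> poly_space 3"
    using r poly_space_mono[OF k] by blast
  then obtain d :: "nat \<Rightarrow> nat \<Rightarrow> real" where d: "\<And>s t. r (x + s, y + t) =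
       (d 0 0 + d 0 1 * t + d 0 2 * t^2 + d 0 3 * t^3)
       + (d 1 0 + d 1 1 * t + d 1 2 * t^2) * s + (d 2 0 + d 2 1 * t) * s^2 + d 3 0 * s^3"
    using cubic_expansion[where x = x and y = y] by blast
  define H K where "H = dx^2 / 12" and "K = dy^2 / 12"
  have int_y: "integral {y - dy/2..y + dy/2} (\<lambda>\<eta>. r (x + s, \<eta>)) / dy =
      (d 0 0 + d 0 2 * K) + (d 1 0 + d 1 2 * K) * s + d 2 0 * s^2 + d 3 0 * s^3" for s
  proof -
    \<comment> \<open>The expansion is regrouped by powers of \<open>t\<close>, the variable being
      averaged.\<close>
    have "r (x + s, y + t) = (d 0 0 + d 1 0 * s + d 2 0 * s^2 + d 3 0 * s^3)
        + (d 0 1 + d 1 1 * s + d 2 1 * s^2) * t + (d 0 2 + d 1 2 * s) * t^2 + d 0 3 * t^3" for t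
      unfolding d by (simp add: algebra_simps)
    from mean_centered_cubic[where f = "\<lambda>\<eta>. r (x + s, \<eta>)", OF mesh(2) this]
    show ?thesis by (simp add: K_def algebra_simps)
  qed
  have int_x: "integral {x - dx/2..x + dx/2} (\<lambda>\<xi>. r (\<xi>, y + t)) / dx =
      (d 0 0 + d 2 0 * H) + (d 0 1 + d 2 1 * H) * t + d 0 2 * t^2 + d 0 3 * t^3" for t
  proof -
    have "r (x + s, y + t) = (d 0 0 + d 0 1 * t + d 0 2 * t^2 + d 0 3 * t^3)
        + (d 1 0 + d 1 1 * t + d 1 2 * t^2) * s + (d 2 0 + d 2 1 * t) * s^2 + d 3 0 * s^3" for s
      by (simp add: d)
    from mean_centered_cubic[where f = "\<lambda>\<xi>. r (\<xi>, y + t)", OF mesh(1) this]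
    show ?thesis by (simp add: H_def algebra_simps)
  qed
  have "integral ({x - dx/2..x + dx/2} \<times> {y - dy/2..y + dy/2}) r =
      integral {x - dx/2..x + dx/2} (\<lambda>\<xi>. integral {y - dy/2..y + dy/2} (\<lambda>\<eta>. r (\<xi>, \<eta>)))"
    using integral_prod_continuous[OF continuous_on_poly_space[OF r]]
    by (simp add: cbox_Pair_eq)
  also have "\<dots> / (dx * dy) =
      integral {x - dx/2..x + dx/2} (\<lambda>\<xi>. integral {y - dy/2..y + dy/2} (\<lambda>\<eta>. r (\<xi>, \<eta>)) / dy) / dx"
    by (simp add: field_simps)
  \<comment> \<open>After Fubini the inner mean is, by \<open>int_y\<close>, again a cubic in the
    other centered variable.\<close>
  also have "\<dots> = d 0 0 + d 0 2 * K + d 2 0 * H"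
    unfolding H_def by (rule mean_centered_cubic[OF mesh(1) int_y])
  finally have cell: "integral ({x - dx/2..x + dx/2} \<times> {y - dy/2..y + dy/2}) r / (dx * dy) =
      d 0 0 + d 0 2 * K + d 2 0 * H" .
  \<comment> \<open>Odd powers of \<open>s\<close> cancel between opposite edges, and
    \<open>(dx/2)^2 = 3 * H\<close>.\<close>
  have edge_x: "(\<Sum>q = 1..Q. w q * r (x - dx/2, zy q)) + (\<Sum>q = 1..Q. w q * r (x + dx/2, zy q)) =
      2 * (d 0 0 + d 0 2 * K + 3 * d 2 0 * H)"
    using int_y[of "- dx/2"] int_y[of "dx/2"]
    unfolding quadrature_exact_slice_right[OF zy r] by (simp add: H_def eval_nat_numeral algebra_simps)
  have edge_y: "(\<Sum>q = 1..Q. w q * r (zx q, y - dy/2)) + (\<Sum>q = 1..Q. w q * r (zx q, y + dy/2)) =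
      2 * (d 0 0 + 3 * d 0 2 * K + d 2 0 * H)"
    using int_x[of "- dy/2"] int_x[of "dy/2"]
    unfolding quadrature_exact_slice_left[OF zx r] by (simp add: K_def eval_nat_numeral algebra_simps)
  \<comment> \<open>One of the two offsets vanishes, so both cases of the optimal node set have this form.\<close>
  have "ex * ey = 0"
    by (simp add: ex ey phis max_def)
  \<comment> \<open>Reflection through the center cancels the terms of odd total degree; the mixed
    term \<open>d 1 1 * ex * ey\<close> vanishes by the product just computed.\<close>
  then have nodes: "r (x + ex, y + ey) + r (x - ex, y - ey) = 2 * (d 0 0 + d 2 0 * ex^2 + d 0 2 * ey^2)"
    using d[of ex ey] d[of "- ex" "- ey"] by (auto simp: algebra_simps)
  have "phis > 0" "phis \<ge> phi1" "phis \<ge> phi2"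
    using phi phis by auto
  \<comment> \<open>The radicands are nonnegative because \<open>phis\<close> is the maximum, and
    \<open>(dx / (2 * sqrt 3))^2 = H\<close>.\<close>
  then have sq: "phis * ex^2 = (phis - phi1) * H" "phis * ey^2 = (phis - phi2) * K"
    by (simp_all add: ex ey H_def K_def power_mult_distrib power_divide field_simps)
  have "phis * (2 * (d 0 0 + d 2 0 * ex^2 + d 0 2 * ey^2)) =
      2 * (phis * d 0 0 + d 2 0 * ((phis - phi1) * H) + d 0 2 * ((phis - phi2) * K))"
    unfolding sq[symmetric] by (simp add: algebra_simps)
  then show ?thesis
    unfolding cell edge_x edge_y nodes by (simp add: field_simps)
qed

text \<open>The scalar identity holds in each component. Naming the nodes \<open>n1\<close> and
  \<open>n2\<close> hides the case split in the optimal node set; they coincide when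
  \<open>phi1 = phi2\<close>.\<close>

lemma cell_average_decomposition:
  fixes p :: "real \<times> real \<Rightarrow> real ^ 'm"
  assumes p: "\<And>l. (\<lambda>z. p z $ l) \<in> poly_space k" and k: "k \<le> 3"
    and mesh: "0 < dx" "0 < dy"
    and zx: "quadrature_exact (grid x0 dx (of_int i - 1/2)) (grid x0 dx (of_int i + 1/2)) Q zx w k"
    and zy: "quadrature_exact (grid y0 dy (of_int j - 1/2)) (grid y0 dy (of_int j + 1/2)) Q zy w k"
    and speeds: "0 < a1" "0 < a2"
    and phi: "phi1 = a1 / dx" "phi2 = a2 / dy" "phis = max phi1 phi2"
  obtains n1 n2 where "n1 \<in> optimal_nodes a1 a2 x0 y0 dx dy i j"
    and "n2 \<in> optimal_nodes a1 a2 x0 y0 dx dy i j"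
    and "(phi1 + phi2 + 2 * phis) *\<^sub>R cell_average x0 y0 dx dy i j p =
      (\<Sum>q = 1..Q. w q *\<^sub>R ((phi1 / 2) *\<^sub>R
         (p (grid x0 dx (of_int i - 1/2), zy q) + p (grid x0 dx (of_int i + 1/2), zy q))))
      + (\<Sum>q = 1..Q. w q *\<^sub>R ((phi2 / 2) *\<^sub>R
         (p (zx q, grid y0 dy (of_int j - 1/2)) + p (zx q, grid y0 dy (of_int j + 1/2)))))
      + phis *\<^sub>R (p n1 + p n2)"
proof -
  define x y where "x = grid x0 dx (of_int i)" and "y = grid y0 dy (of_int j)"
  have gx: "grid x0 dx (of_int i - 1/2) = x - dx/2" "grid x0 dx (of_int i + 1/2) = x + dx/2"
    and gy: "grid y0 dy (of_int j - 1/2) = y - dy/2" "grid y0 dy (of_int j + 1/2) = y + dy/2"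
    by (simp_all add: x_def y_def grid_def algebra_simps)
  define ex where "ex = dx / (2 * sqrt 3) * sqrt ((phis - phi1) / phis)"
  define ey where "ey = dy / (2 * sqrt 3) * sqrt ((phis - phi2) / phis)"
  have phi_pos: "0 < phi1" "0 < phi2"
    using mesh speeds by (simp_all add: phi)
  have "(x + ex, y + ey) \<in> optimal_nodes a1 a2 x0 y0 dx dy i j"
    and "(x - ex, y - ey) \<in> optimal_nodes a1 a2 x0 y0 dx dy i j"
    by (auto simp: optimal_nodes_def Let_def ex_def ey_def x_def y_def phi max_def)
  moreover
  \<comment> \<open>Continuity gives integrability of \<open>p\<close>, so that components commute
    with the integral.\<close>
  have "continuous_on S (\<lambda>z. \<chi> l. p z $ l)" for S
    by (intro continuous_on_vec_lambda continuous_on_poly_space[OF p])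
  then have "continuous_on S p" for S
    by simp
  then have int: "p integrable_on ({x - dx/2..x + dx/2} \<times> {y - dy/2..y + dy/2})"
    using integrable_continuous[of "(x - dx/2, y - dy/2)" "(x + dx/2, y + dy/2)" p]
    by (simp add: cbox_Pair_eq)
  have "((phi1 + phi2 + 2 * phis) *\<^sub>R cell_average x0 y0 dx dy i j p) $ l =
      ((\<Sum>q = 1..Q. w q *\<^sub>R ((phi1 / 2) *\<^sub>R
         (p (grid x0 dx (of_int i - 1/2), zy q) + p (grid x0 dx (of_int i + 1/2), zy q))))
      + (\<Sum>q = 1..Q. w q *\<^sub>R ((phi2 / 2) *\<^sub>R
         (p (zx q, grid y0 dy (of_int j - 1/2)) + p (zx q, grid y0 dy (of_int j + 1/2)))))
      + phis *\<^sub>R (p (x + ex, y + ey) + p (x - ex, y - ey))) $ l" for l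
    using poly_space_mean_decomposition[OF p[of l] k mesh zx[unfolded gx] zy[unfolded gy] phi_pos phi(3) ex_def ey_def]
    by (simp add: gx gy cell_average_def cell_def int sum_distrib_left sum.distrib[symmetric] sum_divide_distrib
        algebra_simps add_divide_distrib)
  then have "(phi1 + phi2 + 2 * phis) *\<^sub>R cell_average x0 y0 dx dy i j p =
      (\<Sum>q = 1..Q. w q *\<^sub>R ((phi1 / 2) *\<^sub>R
         (p (grid x0 dx (of_int i - 1/2), zy q) + p (grid x0 dx (of_int i + 1/2), zy q))))
      + (\<Sum>q = 1..Q. w q *\<^sub>R ((phi2 / 2) *\<^sub>R
         (p (zx q, grid y0 dy (of_int j - 1/2)) + p (zx q, grid y0 dy (of_int j + 1/2)))))
      + phis *\<^sub>R (p (x + ex, y + ey) + p (x - ex, y - ey))"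
    by (simp add: vec_eq_iff)
  ultimately show thesis by (rule that)
qed

section \<open>Bound-preserving fluxes and the update as a convex combination\<close>

text \<open>The cell acts as two half cells with states \<open>u2\<close> and \<open>u3\<close>
  between the outer states \<open>u1\<close> and \<open>u4\<close>. Each half is updated with ratio
  \<open>l\<close>, so their average sees the outer flux difference with ratio
  \<open>l/2\<close>.\<close>

lemma bp_flux_midpoint:
  assumes f: "bp_flux G a c0 f" and G: "convex G"
    and u: "u1 \<in> G" "u2 \<in> G" "u3 \<in> G" "u4 \<in> G"
    and l: "0 < l" "a * l \<le> c0"
  shows "(1/2) *\<^sub>R (u2 + u3) - (l/2) *\<^sub>R (f u3 u4 - f u1 u2) \<in> G"
proof -
  \<comment> \<open>The artificial inner flux \<open>f u2 u3\<close> cancels in the average of the two updates.\<close>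
  have "u2 - l *\<^sub>R (f u2 u3 - f u1 u2) \<in> G" "u3 - l *\<^sub>R (f u3 u4 - f u2 u3) \<in> G"
    using f u l unfolding bp_flux_def by blast+
  then have "(1/2) *\<^sub>R (u2 - l *\<^sub>R (f u2 u3 - f u1 u2))
      + (1/2) *\<^sub>R (u3 - l *\<^sub>R (f u3 u4 - f u2 u3)) \<in> G"
    using G by (intro convexD) auto
  then show ?thesis
    by (simp add: algebra_simps)
qed

theorem corollary3:
  fixes G :: "(real ^ 'm) set"
    and f1 f2 :: "real ^ 'm \<Rightarrow> real ^ 'm \<Rightarrow> real ^ 'm"
    and p :: "int \<Rightarrow> int \<Rightarrow> real \<times> real \<Rightarrow> real ^ 'm"
    and x0 y0 dx dy dt a1 a2 c0 :: real
    and k Q :: nat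
    and w :: "nat \<Rightarrow> real"
    and xG yG :: "int \<Rightarrow> nat \<Rightarrow> real"
  assumes k: "k \<in> {2, 3}"
    and mesh: "0 < dx" "0 < dy"
    and time_step: "0 < dt"
    and G: "convex G"
    and p_poly: "\<And>i j l. (\<lambda>z. p i j z $ l) \<in> poly_space k"
    and gauss_x: "\<And>i. gauss_quadrature (grid x0 dx (of_int i - 1/2))
                         (grid x0 dx (of_int i + 1/2)) Q (xG i) w"
    and gauss_y: "\<And>j. gauss_quadrature (grid y0 dy (of_int j - 1/2))
                         (grid y0 dy (of_int j + 1/2)) Q (yG j) w"
    and exact_x: "\<And>i. quadrature_exact (grid x0 dx (of_int i - 1/2))
                         (grid x0 dx (of_int i + 1/2)) Q (xG i) w k"
    and exact_y: "\<And>j. quadrature_exact (grid y0 dy (of_int j - 1/2))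
                         (grid y0 dy (of_int j + 1/2)) Q (yG j) w k"
    and speeds: "0 < a1" "0 < a2" "0 < c0"
    and flux1: "bp_flux G a1 c0 f1"
    and flux2: "bp_flux G a2 c0 f2"
    and trace_left: "\<And>i j q. q \<in> {1..Q} \<Longrightarrow> p i j (grid x0 dx (of_int i - 1/2), yG j q) \<in> G"
    and trace_right: "\<And>i j q. q \<in> {1..Q} \<Longrightarrow> p i j (grid x0 dx (of_int i + 1/2), yG j q) \<in> G"
    and trace_lower: "\<And>i j q. q \<in> {1..Q} \<Longrightarrow> p i j (xG i q, grid y0 dy (of_int j - 1/2)) \<in> G"
    and trace_upper: "\<And>i j q. q \<in> {1..Q} \<Longrightarrow> p i j (xG i q, grid y0 dy (of_int j + 1/2)) \<in> G"
    and optimal: "\<And>i j z. z \<in> optimal_nodes a1 a2 x0 y0 dx dy i j \<Longrightarrow> p i j z \<in> G"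
    and CFL: "(2 * (a1 / dx) + 2 * (a2 / dy) + 4 * max (a1 / dx) (a2 / dy)) * dt \<le> c0"
  shows "\<forall>i j. scheme_update x0 y0 dx dy dt Q w xG yG f1 f2 p i j \<in> G"
proof (intro allI)
  fix i j
  define phi1 phi2 phis where phi: "phi1 = a1 / dx" "phi2 = a2 / dy" "phis = max phi1 phi2"
  define S where "S = phi1 + phi2 + 2 * phis"
  define xl xr yl yr where x: "xl = grid x0 dx (of_int i - 1/2)" "xr = grid x0 dx (of_int i + 1/2)"
    and y: "yl = grid y0 dy (of_int j - 1/2)" "yr = grid y0 dy (of_int j + 1/2)"
  have pos: "0 < phi1" "0 < phi2" "0 < phis"
    using mesh speeds by (auto simp: phi max_def)
  then have S: "0 < S"
    by (simp add: S_def)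
  have CFL': "2 * S * dt \<le> c0"
    using CFL by (simp add: S_def phi algebra_simps)
  have k3: "k \<le> 3"
    using k by auto
  obtain n1 n2 where n: "n1 \<in> optimal_nodes a1 a2 x0 y0 dx dy i j"
      "n2 \<in> optimal_nodes a1 a2 x0 y0 dx dy i j"
    and avg: "S *\<^sub>R cell_average x0 y0 dx dy i j (p i j) =
      (\<Sum>q = 1..Q. w q *\<^sub>R ((phi1 / 2) *\<^sub>R (p i j (xl, yG j q) + p i j (xr, yG j q))))
      + (\<Sum>q = 1..Q. w q *\<^sub>R ((phi2 / 2) *\<^sub>R (p i j (xG i q, yl) + p i j (xG i q, yr))))
      + phis *\<^sub>R (p i j n1 + p i j n2)"
    using cell_average_decomposition[OF p_poly[of i j] k3 mesh exact_x[of i] exact_y[of j] speeds(1,2) phi,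
        folded S_def x y] by blast
  have w: "\<And>q. q \<in> {1..Q} \<Longrightarrow> 0 \<le> w q" "(\<Sum>q = 1..Q. w q) = 1"
    using gauss_x[of i] by (auto simp: gauss_quadrature_def less_imp_le)

  define F where "F q = f1 (p i j (xr, yG j q)) (p (i + 1) j (xr, yG j q))
              - f1 (p (i - 1) j (xl, yG j q)) (p i j (xl, yG j q))" for q
  define H where "H q = f2 (p i j (xG i q, yr)) (p i (j + 1) (xG i q, yr))
              - f2 (p i (j - 1) (xG i q, yl)) (p i j (xG i q, yl))" for q
  \<comment> \<open>The ratio \<open>2 * S * dt / a1\<close> is chosen so that the weight
    \<open>phi1 / S\<close> turns half of it into \<open>dt / dx\<close>. Multiplied by
    \<open>a1\<close> it is the left side of \<open>CFL'\<close>.\<close>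
  define A where "A q = (1/2) *\<^sub>R (p i j (xl, yG j q) + p i j (xr, yG j q))
      - ((2 * S * dt / a1) / 2) *\<^sub>R F q" for q
  define B where "B q = (1/2) *\<^sub>R (p i j (xG i q, yl) + p i j (xG i q, yr))
      - ((2 * S * dt / a2) / 2) *\<^sub>R H q" for q
  define N where "N = (1/2) *\<^sub>R (p i j n1) + (1/2) *\<^sub>R (p i j n2)"

  \<comment> \<open>Each interface is also an interface of the neighbouring cell, so the trace
    hypotheses of that cell supply the outer states.\<close>
  have xl': "xl = grid x0 dx (of_int (i - 1) + 1/2)" and xr': "xr = grid x0 dx (of_int (i + 1) - 1/2)"
    and yl': "yl = grid y0 dy (of_int (j - 1) + 1/2)" and yr': "yr = grid y0 dy (of_int (j + 1) - 1/2)"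
    by (simp_all add: x y grid_def algebra_simps)
  have A: "A q \<in> G" if "q \<in> {1..Q}" for q
    unfolding A_def F_def
  proof (rule bp_flux_midpoint[OF flux1 G])
    show "p (i - 1) j (xl, yG j q) \<in> G" "p (i + 1) j (xr, yG j q) \<in> G"
      using trace_right[OF that, of "i - 1" j] trace_left[OF that, of "i + 1" j] by (simp_all add: xl' xr')
    show "p i j (xl, yG j q) \<in> G" "p i j (xr, yG j q) \<in> G"
      using trace_right[OF that, of i j] trace_left[OF that, of i j] by (simp_all add: x)
    show "0 < 2 * S * dt / a1" "a1 * (2 * S * dt / a1) \<le> c0"
      using S time_step speeds CFL' by simp_all
  qed
  have B: "B q \<in> G" if "q \<in> {1..Q}" for q
    unfolding B_def H_def
  proof (rule bp_flux_midpoint[OF flux2 G])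
    show "p i (j - 1) (xG i q, yl) \<in> G" "p i (j + 1) (xG i q, yr) \<in> G"
      using trace_upper[OF that, of i "j - 1"] trace_lower[OF that, of i "j + 1"] by (simp_all add: yl' yr')
    show "p i j (xG i q, yl) \<in> G" "p i j (xG i q, yr) \<in> G"
      using trace_upper[OF that, of i j] trace_lower[OF that, of i j] by (simp_all add: y)
    show "0 < 2 * S * dt / a2" "a2 * (2 * S * dt / a2) \<le> c0"
      using S time_step speeds CFL' by simp_all
  qed
  have N: "N \<in> G"
    unfolding N_def using G optimal[OF n(1)] optimal[OF n(2)] by (intro convexD) auto
  \<comment> \<open>The weights sum to 1 by the definition of \<open>S\<close>. The node mean
    \<open>N\<close> does not depend on \<open>q\<close> and enters every \<open>C q\<close> in
    full, since the \<open>w q\<close> also sum to 1.\<close>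
  define C where "C q = (phi1 / S) *\<^sub>R A q + (phi2 / S) *\<^sub>R B q + (2 * phis / S) *\<^sub>R N" for q
  have "C q \<in> G" if "q \<in> {1..Q}" for q
  proof -
    have sum0: "phi1 + phi2 \<noteq> 0"
      using pos by simp
    \<comment> \<open>The three-point combination is nested into two-point ones, the form in which
      convexity is applied.\<close>
    then have "C q = ((phi1 + phi2) / S) *\<^sub>R
        ((phi1 / (phi1 + phi2)) *\<^sub>R A q + (phi2 / (phi1 + phi2)) *\<^sub>R B q) + (2 * phis / S) *\<^sub>R N"
      by (simp add: C_def scaleR_add_right)
    also have "\<dots> \<in> G"
      using A[OF that] B[OF that] N G pos S sum0
      by (intro convexD) (simp_all add: add_divide_distrib[symmetric] S_def[symmetric])
    finally show ?thesis .
  qed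
  then have C_sum: "(\<Sum>q = 1..Q. w q *\<^sub>R C q) \<in> G"
    using w G by (intro convex_sum) auto

  have C: "C q = (1 / S) *\<^sub>R ((phi1 / 2) *\<^sub>R (p i j (xl, yG j q) + p i j (xr, yG j q)))
      + (1 / S) *\<^sub>R ((phi2 / 2) *\<^sub>R (p i j (xG i q, yl) + p i j (xG i q, yr)))
      + (1 / S) *\<^sub>R (phis *\<^sub>R (p i j n1 + p i j n2))
      - (dt / dx) *\<^sub>R F q - (dt / dy) *\<^sub>R H q" for q
  proof -
    have step: "phi1 / S * ((2 * S * dt / a1) / 2) = dt / dx" "phi2 / S * ((2 * S * dt / a2) / 2) = dt / dy"
      using S speeds by (simp_all add: phi)
    have "(phi1 / S) *\<^sub>R A q =
        (1 / S) *\<^sub>R ((phi1 / 2) *\<^sub>R (p i j (xl, yG j q) + p i j (xr, yG j q))) - (dt / dx) *\<^sub>R F q"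
      unfolding A_def by (simp only: scaleR_diff_right scaleR_scaleR step) simp
    moreover have "(phi2 / S) *\<^sub>R B q =
        (1 / S) *\<^sub>R ((phi2 / 2) *\<^sub>R (p i j (xG i q, yl) + p i j (xG i q, yr))) - (dt / dy) *\<^sub>R H q"
      unfolding B_def by (simp only: scaleR_diff_right scaleR_scaleR step) simp
    moreover have "(2 * phis / S) *\<^sub>R N = (1 / S) *\<^sub>R (phis *\<^sub>R (p i j n1 + p i j n2))"
      unfolding N_def by (simp add: scaleR_add_right)
    ultimately show ?thesis
      unfolding C_def by simp
  qed
  \<comment> \<open>The factor \<open>S\<close> and its inverse are inserted so that
    \<open>avg\<close> can replace the cell average.\<close>
  have "scheme_update x0 y0 dx dy dt Q w xG yG f1 f2 p i j =
      (1 / S) *\<^sub>R (S *\<^sub>R cell_average x0 y0 dx dy i j (p i j))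
      - (dt / dx) *\<^sub>R (\<Sum>q = 1..Q. w q *\<^sub>R F q) - (dt / dy) *\<^sub>R (\<Sum>q = 1..Q. w q *\<^sub>R H q)"
    using S by (simp add: scheme_update_def Let_def F_def H_def x y)
  also have "\<dots> = (\<Sum>q = 1..Q. w q *\<^sub>R C q)"
  proof -
    have const: "(\<Sum>q = 1..Q. (1 / S) *\<^sub>R phis *\<^sub>R w q *\<^sub>R v) = (1 / S) *\<^sub>R phis *\<^sub>R v" for v :: "real ^ 'm"
      by (simp only: scaleR_sum_right[symmetric] scaleR_sum_left[symmetric] w(2) scaleR_one)
    show ?thesis
      unfolding avg C
      by (simp only: scaleR_add_right scaleR_diff_right scaleR_sum_right sum.distrib sum_subtractf
          scaleR_left_commute[of "w _"] const)
  qed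
  finally show "scheme_update x0 y0 dx dy dt Q w xG yG f1 f2 p i j \<in> G"
    using C_sum by simp
qed

end
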